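(* For every real Banach space $X$ with $\dim X\ge2$, $$\frac{J_B(X)^2}{2}\le C^B_{-\infty}(X)\le1+\bigl(J_B(X)-1\bigr)^2.$$ In particular, if $J_B(X)<2$, then $C^B_{-\infty}(X)<2$.
   Context: $S_X$ denotes the unit sphere of $X$. For $x,y\in X$, Birkhoff-James orthogonality $x\perp_B y$ means $\|x+\lambda y\|\ge\|x\|$ for all $\lambda\in\mathbb{R}$. Define $$J_B(X)=\sup\{\min(\|x+y\|,\|x-y\|):x,y\in S_X,\ x\perp_B y\},$$ and, for $\tau\ge0$, $$J^B_{X,-\infty}(\tau)=\sup\{\min(\|x+\tau y\|,\|x-\tau y\|): x,y\in S_X,\ x\perp_B y\},\qquad C^B_{-\infty}(X)=\sup_{0\le\tau\le1}\frac{J^B_{X,-\infty}(\tau)^2}{1+\tau^2}.$$ *)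

theory Defs
  imports "HOL-Analysis.Analysis"
begin

definition birkhoff_orthogonal :: "'a::real_normed_vector \<Rightarrow> 'a \<Rightarrow> bool"  (infix "\<bottom>\<^sub>B" 50)
  where "x \<bottom>\<^sub>B y \<longleftrightarrow> (\<forall>l::real. norm (x + l *\<^sub>R y) \<ge> norm x)"

(* The space X is the type 'a, passed as TYPE('a). The suprema below are taken in the reals:
   if dim X >= 2, the index sets are nonempty, and the terms are bounded by 2, by 1 + \<tau> and
   by 2, respectively. *)

definition J_B :: "'a::real_normed_vector itself \<Rightarrow> real"
  where "J_B _ = Sup {min (norm (x + y)) (norm (x - y)) | x y :: 'a.
      x \<in> sphere 0 1 \<and> y \<in> sphere 0 1 \<and> x \<bottom>\<^sub>B y}"

definition J_B_minf :: "'a::real_normed_vector itself \<Rightarrow> real \<Rightarrow> real"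
  where "J_B_minf _ \<tau> = Sup {min (norm (x + \<tau> *\<^sub>R y)) (norm (x - \<tau> *\<^sub>R y)) | x y :: 'a.
      x \<in> sphere 0 1 \<and> y \<in> sphere 0 1 \<and> x \<bottom>\<^sub>B y}"

definition C_B_minf :: "'a::real_normed_vector itself \<Rightarrow> real"
  where "C_B_minf X = (SUP \<tau>\<in>{0..1}. (J_B_minf X \<tau>)\<^sup>2 / (1 + \<tau>\<^sup>2))"

end

theory Submission
  imports Defs
begin

text \<open>For \<open>\<tau> \<in> [0, 1]\<close>, convexity of the norm along \<open>x \<plusminus> \<tau> y = (1 - \<tau>) x + \<tau> (x \<plusminus> y)\<close> gives
  \<open>J_B_minf X \<tau> \<le> 1 + \<tau> (J_B X - 1)\<close>, and the Cauchy--Schwarz inequality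
  \<open>(1 + \<tau> a)\<^sup>2 \<le> (1 + \<tau>\<^sup>2) (1 + a\<^sup>2)\<close> turns this into the upper bound. The lower bound is
  the value at \<open>\<tau> = 1\<close>. Orthogonal unit pairs exist because a residual of
  best approximation from a line is orthogonal to that line; they also show \<open>1 \<le> J_B X\<close>.\<close>

lemma birkhoff_orthogonal_scaleR:
  assumes "x \<bottom>\<^sub>B y" "a \<noteq> 0"
  shows "a *\<^sub>R x \<bottom>\<^sub>B b *\<^sub>R y"
  unfolding birkhoff_orthogonal_def
proof
  fix l :: real
  have "a *\<^sub>R x + l *\<^sub>R b *\<^sub>R y = a *\<^sub>R (x + (l * b / a) *\<^sub>R y)"
    using assms(2) by (simp add: scaleR_add_right)
  then show "norm (a *\<^sub>R x) \<le> norm (a *\<^sub>R x + l *\<^sub>R b *\<^sub>R y)"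
    using assms(1) by (simp add: birkhoff_orthogonal_def mult_left_mono)
qed

text \<open>Choose \<open>t\<close> minimising the distance from \<open>y\<close> to the line
  through \<open>x\<close>; any further shift along \<open>x\<close> stays on that line, so it
  cannot shorten the residual.\<close>

lemma exists_birkhoff_orthogonal_residual:
  fixes x y :: "'a::real_normed_vector"
  shows "\<exists>t. y + t *\<^sub>R x \<bottom>\<^sub>B x"
proof (cases "x = 0")
  case True
  then show ?thesis by (simp add: birkhoff_orthogonal_def)
next
  case False
  \<comment> \<open>If \<open>s\<close> lies outside \<open>{-r..r}\<close>, then
    \<open>y + s *\<^sub>R x\<close> has norm at least \<open>2 * norm y - norm y\<close>, so it
    does not beat \<open>s = 0\<close>. A minimum over this compact interval is therefore
    global.\<close>
  define r where "r = 2 * norm y / norm x"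
  have "r \<ge> 0" by (simp add: r_def)
  then have "\<exists>t\<in>{-r..r}. \<forall>s\<in>{-r..r}. norm (y + t *\<^sub>R x) \<le> norm (y + s *\<^sub>R x)"
    by (intro continuous_attains_inf continuous_intros) auto
  then obtain t where t: "\<And>s. \<bar>s\<bar> \<le> r \<Longrightarrow> norm (y + t *\<^sub>R x) \<le> norm (y + s *\<^sub>R x)"
    by (fastforce simp: abs_le_iff)
  have min: "norm (y + t *\<^sub>R x) \<le> norm (y + s *\<^sub>R x)" for s
  proof (cases "\<bar>s\<bar> \<le> r")
    case True
    then show ?thesis by (rule t)
  next
    case outside: False
    then have "2 * norm y \<le> norm (s *\<^sub>R x)"
      using False by (simp add: r_def field_simps)
    moreover have "norm (s *\<^sub>R x) \<le> norm (y + s *\<^sub>R x) + norm y"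
      using norm_triangle_ineq4[of "y + s *\<^sub>R x" y] by simp
    ultimately show ?thesis
      using t[of 0] \<open>r \<ge> 0\<close> by simp
  qed
  have "norm (y + t *\<^sub>R x) \<le> norm (y + t *\<^sub>R x + l *\<^sub>R x)" for l
    using min[of "t + l"] by (simp add: scaleR_add_left add.assoc)
  then show ?thesis
    unfolding birkhoff_orthogonal_def by blast
qed

text \<open>Orthogonality is not symmetric: the residual of \<open>v\<close> modulo \<open>u\<close>
  must stand on the left. Independence makes it nonzero, so both vectors can be normalised.\<close>

lemma exists_unit_birkhoff_orthogonal:
  fixes B :: "'a::real_normed_vector set"
  assumes "independent B" "card B = 2"
  shows "\<exists>x y :: 'a. norm x = 1 \<and> norm y = 1 \<and> x \<bottom>\<^sub>B y"
proof -
  obtain u v where B: "B = {u, v}" "u \<noteq> v"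
    using assms(2) by (auto simp: card_2_iff)
  have "v \<notin> span {u}" "u \<noteq> 0"
    using assms(1) B by (auto simp: independent_insert insert_commute[of u v] dest: dependent_zero)
  obtain t where t: "v + t *\<^sub>R u \<bottom>\<^sub>B u"
    using exists_birkhoff_orthogonal_residual by blast
  define z where "z = v + t *\<^sub>R u"
  have "z \<noteq> 0"
  proof
    assume "z = 0"
    then have "v = (- t) *\<^sub>R u"
      by (simp add: z_def eq_neg_iff_add_eq_0)
    then show False
      using \<open>v \<notin> span {u}\<close> by (metis span_base span_scale singletonI)
  qed
  have "(1 / norm z) *\<^sub>R z \<bottom>\<^sub>B (1 / norm u) *\<^sub>R u"
    using t \<open>z \<noteq> 0\<close> by (intro birkhoff_orthogonal_scaleR) (auto simp: z_def)
  moreover have "norm ((1 / norm z) *\<^sub>R z) = 1" "norm ((1 / norm u) *\<^sub>R u) = 1"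
    using \<open>z \<noteq> 0\<close> \<open>u \<noteq> 0\<close> by auto
  ultimately show ?thesis by blast
qed

lemma J_B_minf_one: "J_B_minf X 1 = J_B X"
  by (simp add: J_B_minf_def J_B_def)

lemma J_B_upper:
  fixes x y :: "'a::real_normed_vector"
  assumes "norm x = 1" "norm y = 1" "x \<bottom>\<^sub>B y"
  shows "min (norm (x + y)) (norm (x - y)) \<le> J_B TYPE('a)"
  unfolding J_B_def
proof (rule cSup_upper)
  have "min (norm (u + v)) (norm (u - v)) \<le> 2" if "norm u = 1" "norm v = 1" for u v :: 'a
    using norm_triangle_ineq[of u v] that by simp
  then show "bdd_above {min (norm (x + y)) (norm (x - y)) | x y :: 'a.
      x \<in> sphere 0 1 \<and> y \<in> sphere 0 1 \<and> x \<bottom>\<^sub>B y}"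
    by (intro bdd_aboveI[of _ 2]) auto
qed (use assms in auto)

text \<open>Orthogonality is used at the two scalars \<open>t\<close> and \<open>-t\<close>.\<close>

lemma birkhoff_orthogonal_min_ge:
  assumes "x \<bottom>\<^sub>B y"
  shows "norm x \<le> min (norm (x + t *\<^sub>R y)) (norm (x - t *\<^sub>R y))"
  using assms unfolding birkhoff_orthogonal_def
  by (metis min.boundedI scaleR_minus_left diff_conv_add_uminus)

lemma J_B_ge_1:
  fixes x y :: "'a::real_normed_vector"
  assumes "norm x = 1" "norm y = 1" "x \<bottom>\<^sub>B y"
  shows "1 \<le> J_B TYPE('a)"
  using J_B_upper[OF assms] birkhoff_orthogonal_min_ge[OF assms(3), of 1] assms(1) by (auto dest: order_trans)

text \<open>The point \<open>x + t *\<^sub>R y\<close> lies on the segment from \<open>x\<close> to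
  \<open>x + y\<close>.\<close>

lemma norm_add_scaleR_convex:
  fixes x y :: "'a::real_normed_vector"
  assumes "0 \<le> t" "t \<le> 1"
  shows "norm (x + t *\<^sub>R y) \<le> (1 - t) * norm x + t * norm (x + y)"
proof -
  have "x + t *\<^sub>R y = (1 - t) *\<^sub>R x + t *\<^sub>R (x + y)"
    by (simp add: algebra_simps)
  then show ?thesis
    using norm_triangle_ineq[of "(1 - t) *\<^sub>R x" "t *\<^sub>R (x + y)"] assms by simp
qed

lemma min_norm_le_J_B:
  fixes x y :: "'a::real_normed_vector"
  assumes "norm x = 1" "norm y = 1" "x \<bottom>\<^sub>B y" "0 \<le> t" "t \<le> 1"
  shows "min (norm (x + t *\<^sub>R y)) (norm (x - t *\<^sub>R y)) \<le> 1 + t * (J_B TYPE('a) - 1)"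
proof -
  let ?m = "min (norm (x + y)) (norm (x - y))"
  \<comment> \<open>Convexity is applied to \<open>y\<close> and to \<open>- y\<close>; since
    \<open>t\<close> is nonnegative, the increasing map \<open>s \<mapsto> (1 - t) + t * s\<close>
    commutes with \<open>min\<close>.\<close>
  have "min (norm (x + t *\<^sub>R y)) (norm (x - t *\<^sub>R y)) \<le> (1 - t) + t * ?m"
    using norm_add_scaleR_convex[OF assms(4,5), of x y]
      norm_add_scaleR_convex[OF assms(4,5), of x "- y"] assms(1)
    by (simp add: min_def)
  also have "\<dots> \<le> (1 - t) + t * J_B TYPE('a)"
    using J_B_upper[OF assms(1-3)] assms(4) by (simp add: mult_left_mono)
  finally show ?thesis by (simp add: algebra_simps)
qed

text \<open>The given pair shows that the supremum is over a nonempty set. Nonnegativity is what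
  later permits squaring the upper bound.\<close>

lemma J_B_minf_bounds:
  fixes x y :: "'a::real_normed_vector"
  assumes "norm x = 1" "norm y = 1" "x \<bottom>\<^sub>B y" "0 \<le> t" "t \<le> 1"
  shows "0 \<le> J_B_minf TYPE('a) t" "J_B_minf TYPE('a) t \<le> 1 + t * (J_B TYPE('a) - 1)"
proof -
  let ?S = "{min (norm (x + t *\<^sub>R y)) (norm (x - t *\<^sub>R y)) | x y :: 'a.
      x \<in> sphere 0 1 \<and> y \<in> sphere 0 1 \<and> x \<bottom>\<^sub>B y}"
  let ?m = "min (norm (x + t *\<^sub>R y)) (norm (x - t *\<^sub>R y))"
  have mem: "?m \<in> ?S"
    using assms by auto
  have upper: "s \<le> 1 + t * (J_B TYPE('a) - 1)" if "s \<in> ?S" for s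
    using that min_norm_le_J_B[OF _ _ _ assms(4,5)] by auto
  have "0 \<le> ?m"
    by simp
  also have "?m \<le> Sup ?S"
    by (rule cSup_upper[OF mem], rule bdd_aboveI, erule upper)
  finally show "0 \<le> J_B_minf TYPE('a) t"
    by (simp add: J_B_minf_def)
  have "Sup ?S \<le> 1 + t * (J_B TYPE('a) - 1)"
    by (rule cSup_least) (use mem upper in blast)+
  then show "J_B_minf TYPE('a) t \<le> 1 + t * (J_B TYPE('a) - 1)"
    by (simp add: J_B_minf_def)
qed

text \<open>This is Cauchy-Schwarz for the vectors \<open>(1, t)\<close> and \<open>(1, a)\<close>;
  the defect is exactly \<open>(t - a)\<^sup>2\<close>.\<close>

lemma Cauchy_Schwarz_one_plus:
  fixes a t :: real
  shows "(1 + t * a)\<^sup>2 / (1 + t\<^sup>2) \<le> 1 + a\<^sup>2"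
proof -
  have "(1 + a\<^sup>2) * (1 + t\<^sup>2) - (1 + t * a)\<^sup>2 = (t - a)\<^sup>2"
    by (simp add: power2_eq_square algebra_simps)
  moreover have "0 \<le> (t - a)\<^sup>2" by simp
  ultimately have "(1 + t * a)\<^sup>2 \<le> (1 + a\<^sup>2) * (1 + t\<^sup>2)" by linarith
  moreover have "0 < 1 + t\<^sup>2" by (simp add: add_pos_nonneg)
  ultimately show ?thesis by (simp add: pos_divide_le_eq)
qed

theorem corollary9:
  assumes "\<exists>B :: 'a::banach set. independent B \<and> card B = 2"
  shows "(J_B TYPE('a))\<^sup>2 / 2 \<le> C_B_minf TYPE('a)
    \<and> C_B_minf TYPE('a) \<le> 1 + (J_B TYPE('a) - 1)\<^sup>2
    \<and> (J_B TYPE('a) < 2 \<longrightarrow> C_B_minf TYPE('a) < 2)"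
proof -
  obtain x y :: 'a where xy: "norm x = 1" "norm y = 1" "x \<bottom>\<^sub>B y"
    using assms exists_unit_birkhoff_orthogonal by blast
  let ?J = "J_B TYPE('a)"
  let ?f = "\<lambda>t. (J_B_minf TYPE('a) t)\<^sup>2 / (1 + t\<^sup>2)"
  have le: "?f t \<le> 1 + (?J - 1)\<^sup>2" if "t \<in> {0..1}" for t
  proof -
    have "?f t \<le> (1 + t * (?J - 1))\<^sup>2 / (1 + t\<^sup>2)"
      using J_B_minf_bounds[OF xy, of t] that
      by (intro divide_right_mono power_mono) auto
    also have "\<dots> \<le> 1 + (?J - 1)\<^sup>2"
      by (rule Cauchy_Schwarz_one_plus)
    finally show ?thesis .
  qed
  \<comment> \<open>The uniform bound \<open>le\<close> also supplies the boundedness that makes the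
    real supremum dominate its term at 1.\<close>
  have "?f 1 \<le> C_B_minf TYPE('a)"
    unfolding C_B_minf_def
    by (rule cSUP_upper) (simp, rule bdd_aboveI2, erule le)
  then have lower: "?J\<^sup>2 / 2 \<le> C_B_minf TYPE('a)"
    by (simp add: J_B_minf_one)
  have upper: "C_B_minf TYPE('a) \<le> 1 + (?J - 1)\<^sup>2"
    unfolding C_B_minf_def by (rule cSUP_least) (use le in auto)
  \<comment> \<open>The bound \<open>1 \<le> ?J\<close> keeps \<open>?J - 1\<close> in
    \<open>{0..<1}\<close>, so its square is below 1.\<close>
  have "(?J - 1)\<^sup>2 < 1" if "?J < 2"
    using J_B_ge_1[OF xy] that by (simp add: abs_square_less_1)
  then show ?thesis
    using lower upper by fastforce
qed

end
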